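(* Consider the yaw rate and steering dynamics $$\dot r_{dyn}=a_{21}\beta+a_{22}r_{dyn}+b_{21}\varphi_{act}+\delta_r,\qquad \dot\varphi_{act}=\omega,$$ with the steering rate $\omega$ as control input. Let $r_e=r_{kin}-r_{dyn}$ be the yaw rate error, $\sigma_r$ its integral ($\dot\sigma_r=r_e$), let $$\varphi_{des}=-\frac{a_{21}\beta-\dot r_{kin}+a_{22}r_{kin}-K_{p1}r_e-K_{i1}\sigma_r}{b_{21}}$$ with $K_{p1}>a_{22}$ and $K_{i1}>0$ be the desired steering angle, and let $\varphi_e=\varphi_{des}-\varphi_{act}$ be the steering angle error. Backstepping steering tracking control provides asymptotic convergence of the yaw rate error $r_e$ and the steering error $\varphi_e$ using $$\omega=-\frac{a_{21}\dot\beta+(a_{22}\dot r_{kin}-\ddot r_{kin})-K_{p1}\dot r_e-(K_{i1}+b_{21})r_e}{b_{21}}+K_{p2}\varphi_e+K_{i2}\sigma_\varphi,$$ where $\sigma_\varphi$ is the integral of $\varphi_e$ ($\dot\sigma_\varphi=\varphi_e$), $K_{p2}>a_{22}$, and $K_{i2}>0$.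
   Context: The equations are part of a linear slip-yaw bicycle model of a vehicle: $\beta$ is the sideslip angle, $r_{dyn}$ the yaw rate of the vehicle, $\varphi_{act}$ the actual steering angle, $\omega$ the steering rate, $r_{kin}$ the reference yaw rate supplied by a kinematic controller, and $\delta_r$ collects higher order terms from linearization and perturbations due to speed variations and terrain. The coefficients are $a_{21}=-\frac{C_fL_f-C_rL_r}{J}$, $a_{22}=-\frac{C_fL_f^2+C_rL_r^2}{Jv}$, $b_{21}=\frac{C_fL_f}{J}$, where $C_f,C_r$ are the front and rear cornering stiffnesses, $L_f,L_r$ are the distances from the center of gravity to the front and rear axles, $J$ is the rotational inertia, and $v$ is the vehicle speed. Time-varying terms are assumed to vary slowly, so that they are treated as time invariant in the backstepping design. Dots denote time derivatives.
   Formalization: The condition K_{p2} ≥ 0 is added to K_{p2} > a_{22}: since a_{22} < 0, the stated condition alone admits divergence, e.g. a_{21}=0, a_{22}=−4, b_{21}=7, K_{p1}=K_{i1}=K_{i2}=1, K_{p2}=−3, with r_e=φ_e=e^t. *)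

theory Defs
  imports "HOL-Analysis.Analysis"
begin

end

theory Submission
  imports Defs "HOL-Library.Landau_Symbols"
begin

text \<open>
  In the variables \<open>x = r\<^sub>e\<close>, \<open>s = \<sigma>\<^sub>r + \<delta>\<^sub>r / K\<^sub>i\<^sub>1\<close>, \<open>y = \<phi>\<^sub>e\<close>, \<open>z = \<sigma>\<^sub>\<phi>\<close> the closed loop is the
  autonomous linear system \<open>x' = - k x - c s + b y\<close>, \<open>s' = x\<close>, \<open>y' = - x - d y - e z\<close>, \<open>z' = y\<close>
  with \<open>k = K\<^sub>p\<^sub>1 - a\<^sub>2\<^sub>2\<close>, \<open>c = K\<^sub>i\<^sub>1\<close>, \<open>b = b\<^sub>2\<^sub>1\<close>, \<open>d = K\<^sub>p\<^sub>2\<close>, \<open>e = K\<^sub>i\<^sub>2\<close>. The function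
  \<open>V = x\<^sup>2 + c s\<^sup>2 + b y\<^sup>2 + b e z\<^sup>2\<close> satisfies \<open>V' = - 2 k x\<^sup>2 - 2 b d y\<^sup>2 \<le> 0\<close>, so the state is
  bounded and \<open>V\<close> converges. By Barbalat's lemma \<open>V' \<rightarrow> 0\<close>, hence \<open>x \<rightarrow> 0\<close>. For \<open>d = 0\<close> this says
  nothing about \<open>y\<close>; instead Barbalat's lemma is applied along the chain \<open>x' \<rightarrow> 0\<close>, \<open>x'' \<rightarrow> 0\<close>,
  whence \<open>y' \<rightarrow> 0\<close>, then \<open>y'' \<rightarrow> 0\<close>, whence \<open>y \<rightarrow> 0\<close>.
\<close>

text \<open>The bound on \<open>f''\<close> keeps \<open>f'\<close> nearly constant over windows of
  a fixed length \<open>h\<close>, while convergence of \<open>f\<close> forces the mean slope over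
  such windows to 0. Hence \<open>f'\<close> itself is eventually small.\<close>

lemma barbalat:
  fixes f f' f'' :: "real \<Rightarrow> real"
  assumes f: "\<forall>\<^sub>F t in at_top. (f has_real_derivative f' t) (at t)"
    and f': "\<forall>\<^sub>F t in at_top. (f' has_real_derivative f'' t) (at t)"
    and f'': "f'' \<in> O[at_top](\<lambda>_. 1)"
    and lim: "(f \<longlongrightarrow> l) at_top"
  shows "(f' \<longlongrightarrow> 0) at_top"
proof (rule tendstoI)
  fix \<epsilon> :: real assume "\<epsilon> > 0"
  obtain M where "M > 0" and M: "\<forall>\<^sub>F t in at_top. \<bar>f'' t\<bar> \<le> M"
    using f'' by (auto elim!: landau_o.bigE)
  \<comment> \<open>Chosen so that \<open>h * M\<close> is \<epsilon>/2: over a window of length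
    \<open>h\<close>, \<open>f'\<close> varies by at most half the tolerance, and the mean slope may
    use the other half.\<close>
  define h where "h = \<epsilon> / (2 * M)"
  have "h > 0" using \<open>\<epsilon> > 0\<close> \<open>M > 0\<close> by (simp add: h_def)
  have "filterlim (\<lambda>t. t + h) at_top at_top"
    using filterlim_tendsto_add_at_top[OF tendsto_const filterlim_ident, of h]
    by (simp add: add.commute)
  with lim have "((\<lambda>t. f (t + h)) \<longlongrightarrow> l) at_top"
    by (rule filterlim_compose)
  from tendsto_diff[OF this lim]
  have "((\<lambda>t. f (t + h) - f t) \<longlongrightarrow> 0) at_top" by simp
  moreover have "h * \<epsilon> / 2 > 0" using \<open>h > 0\<close> \<open>\<epsilon> > 0\<close> by simp
  ultimately have small: "\<forall>\<^sub>F t in at_top. \<bar>f (t + h) - f t\<bar> < h * \<epsilon> / 2"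
    using tendstoD by fastforce
  obtain T where T: "\<And>t. t \<ge> T \<Longrightarrow> (f has_real_derivative f' t) (at t)"
      "\<And>t. t \<ge> T \<Longrightarrow> (f' has_real_derivative f'' t) (at t)" "\<And>t. t \<ge> T \<Longrightarrow> \<bar>f'' t\<bar> \<le> M"
      "\<And>t. t \<ge> T \<Longrightarrow> \<bar>f (t + h) - f t\<bar> < h * \<epsilon> / 2"
    using eventually_conj[OF eventually_conj[OF f f'] eventually_conj[OF M small]]
    by (auto simp: eventually_at_top_linorder)
  have "\<bar>f' t\<bar> < \<epsilon>" if "t \<ge> T" for t
  proof -
    \<comment> \<open>\<open>f' u\<close> is the mean slope over the window, and a second use of the
      mean value theorem compares it with \<open>f' t\<close>.\<close>
    obtain u where u: "t < u" "u < t + h" "f (t + h) - f t = h * f' u"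
      using MVT2[of t "t + h" f f'] T(1) \<open>h > 0\<close> \<open>t \<ge> T\<close> by auto
    obtain w where w: "t < w" "w < u" "f' u - f' t = (u - t) * f'' w"
      using MVT2[of t u f' f''] T(2) u \<open>t \<ge> T\<close> by auto
    have "h * \<bar>f' u\<bar> < h * (\<epsilon> / 2)"
      using T(4)[OF \<open>t \<ge> T\<close>] u(3) \<open>h > 0\<close> by (simp add: abs_mult)
    then have "\<bar>f' u\<bar> < \<epsilon> / 2" using \<open>h > 0\<close> by simp
    moreover have "\<bar>f' u - f' t\<bar> \<le> h * M"
      unfolding w(3) abs_mult using u w T(3)[of w] \<open>t \<ge> T\<close> by (intro mult_mono) auto
    moreover have "h * M = \<epsilon> / 2" using \<open>M > 0\<close> by (simp add: h_def)
    ultimately show ?thesis by linarith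
  qed
  then show "\<forall>\<^sub>F t in at_top. dist (f' t) 0 < \<epsilon>"
    by (auto simp: eventually_at_top_linorder)
qed

lemma antimono_bounded_tendsto_at_top:
  fixes f :: "real \<Rightarrow> real"
  assumes anti: "\<And>s t. a \<le> s \<Longrightarrow> s \<le> t \<Longrightarrow> f t \<le> f s"
    and lower: "\<And>t. a \<le> t \<Longrightarrow> m \<le> f t"
  obtains l where "(f \<longlongrightarrow> l) at_top"
proof
  have bdd: "bdd_below (f ` {a..})" using lower by (intro bdd_belowI2) auto
  show "(f \<longlongrightarrow> Inf (f ` {a..})) at_top"
  proof (rule decreasing_tendsto)
    show "\<forall>\<^sub>F t in at_top. Inf (f ` {a..}) \<le> f t"
      using eventually_ge_at_top[of a] by eventually_elim (auto intro: cInf_lower bdd)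
  next
    fix x assume "Inf (f ` {a..}) < x"
    then obtain s where s: "s \<ge> a" "f s < x" using bdd by (auto simp: cInf_less_iff)
    show "\<forall>\<^sub>F t in at_top. f t < x"
      using eventually_ge_at_top[of s] by eventually_elim (use anti s in fastforce)
  qed
qed

lemma closed_loop_tendsto_0:
  fixes x s y z :: "real \<Rightarrow> real" and k c b d e :: real
  assumes pos: "k > 0" "c > 0" "b > 0" "d \<ge> 0" "e > 0"
    and x: "\<And>t. t > 0 \<Longrightarrow> (x has_real_derivative - k * x t - c * s t + b * y t) (at t)"
    and s: "\<And>t. t > 0 \<Longrightarrow> (s has_real_derivative x t) (at t)"
    and y: "\<And>t. t > 0 \<Longrightarrow> (y has_real_derivative - x t - d * y t - e * z t) (at t)"
    and z: "\<And>t. t > 0 \<Longrightarrow> (z has_real_derivative y t) (at t)"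
  shows "(x \<longlongrightarrow> 0) at_top" and "(y \<longlongrightarrow> 0) at_top"
proof -
  \<comment> \<open>The successive time derivatives of \<open>x\<close> and \<open>y\<close>, with
    the system equations substituted. Each is a linear combination of the state variables or of
    earlier derivatives, so boundedness passes up the list.\<close>
  define x1 y1 x2 y2 where "x1 = (\<lambda>t. - k * x t - c * s t + b * y t)"
    and "y1 = (\<lambda>t. - x t - d * y t - e * z t)"
    and "x2 = (\<lambda>t. - k * x1 t - c * x t + b * y1 t)"
    and "y2 = (\<lambda>t. - x1 t - d * y1 t - e * y t)"
  define x3 y3 where "x3 = (\<lambda>t. - k * x2 t - c * x1 t + b * y2 t)"
    and "y3 = (\<lambda>t. - x2 t - d * y2 t - e * y1 t)"
  have dx: "(x has_real_derivative x1 t) (at t)" and dy: "(y has_real_derivative y1 t) (at t)"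
    if "t > 0" for t
    using x[OF that] y[OF that] by (simp_all add: x1_def y1_def)
  note d = dx dy s z
  have dx1: "(x1 has_real_derivative x2 t) (at t)" and dy1: "(y1 has_real_derivative y2 t) (at t)"
    if "t > 0" for t
    unfolding x1_def[abs_def] y1_def[abs_def] x2_def y2_def
    by (auto intro!: derivative_eq_intros d that simp: x1_def y1_def)
  have dx2: "(x2 has_real_derivative x3 t) (at t)" and dy2: "(y2 has_real_derivative y3 t) (at t)"
    if "t > 0" for t
    unfolding x2_def[abs_def] y2_def[abs_def] x3_def y3_def
    by (auto intro!: derivative_eq_intros d dx1 dy1 that simp: x2_def y2_def)
  have ev: "\<forall>\<^sub>F t in at_top. P t" if "\<And>t :: real. t > 0 \<Longrightarrow> P t" for P
    using eventually_gt_at_top[of 0] by eventually_elim (rule that)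

  \<comment> \<open>The weights make every cross term cancel: \<open>c\<close> pairs
    \<open>s\<close> with \<open>x\<close>, \<open>b\<close> balances \<open>b * y\<close> in
    \<open>x'\<close> against \<open>- x\<close> in \<open>y'\<close>, and \<open>b * e\<close>
    pairs \<open>z\<close> with \<open>y\<close>.\<close>
  define V V1 V2 where "V = (\<lambda>t. (x t)\<^sup>2 + c * (s t)\<^sup>2 + b * (y t)\<^sup>2 + b * e * (z t)\<^sup>2)"
    and "V1 = (\<lambda>t. - 2 * k * (x t * x t) - 2 * b * d * (y t * y t))"
    and "V2 = (\<lambda>t. - 4 * k * (x t * x1 t) - 4 * b * d * (y t * y1 t))"
  have dV: "(V has_real_derivative V1 t) (at t)" if "t > 0" for t
  proof -
    have "(V has_real_derivative
        2 * (x t * x1 t) + 2 * c * (s t * x t) + 2 * b * (y t * y1 t) + 2 * b * e * (z t * y t))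
        (at t)"
      unfolding V_def by (rule derivative_eq_intros d that refl)+ (simp add: field_simps)
    moreover have "2 * (x t * x1 t) + 2 * c * (s t * x t) + 2 * b * (y t * y1 t)
        + 2 * b * e * (z t * y t) = V1 t"
      by (simp add: x1_def y1_def V1_def algebra_simps)
    ultimately show ?thesis by simp
  qed
  have dV1: "(V1 has_real_derivative V2 t) (at t)" if "t > 0" for t
    unfolding V1_def V2_def
    by (rule derivative_eq_intros d that refl)+ (simp add: algebra_simps)
  have dissipation: "0 \<le> k * (x t * x t)" "0 \<le> b * d * (y t * y t)" for t
    using pos by simp_all
  have V1_nonpos: "V1 t \<le> 0" for t
    using dissipation[of t] unfolding V1_def by linarith
  \<comment> \<open>The derivatives are available only for positive times, so monotonicity on a
    closed ray starts at time 1.\<close>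
  have anti: "V t \<le> V u" if "1 \<le> u" "u \<le> t" for u t
  proof (rule DERIV_nonpos_imp_nonincreasing[OF that(2)])
    fix w assume "u \<le> w"
    with that(1) dV[of w] V1_nonpos[of w]
    show "\<exists>D. (V has_real_derivative D) (at w) \<and> D \<le> 0" by auto
  qed
  have terms: "0 \<le> (x t)\<^sup>2" "0 \<le> c * (s t)\<^sup>2" "0 \<le> b * (y t)\<^sup>2" "0 \<le> b * e * (z t)\<^sup>2" for t
    using pos by auto
  then have "0 \<le> V t" for t by (simp add: V_def)
  with anti obtain l where V_lim: "(V \<longlongrightarrow> l) at_top"
    by (rule antimono_bounded_tendsto_at_top)

  have bounded: "f \<in> O[at_top](\<lambda>_. 1)" if "a > 0" and le: "\<And>t. a * (f t)\<^sup>2 \<le> V t" for a f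
  proof (rule landau_o.bigI)
    show "\<forall>\<^sub>F t in at_top. norm (f t) \<le> (1 + V 1 / a) * norm (1 :: real)"
      using eventually_ge_at_top[of 1]
    proof eventually_elim
      case (elim t)
      have "(f t)\<^sup>2 \<le> V 1 / a"
        using le[of t] anti[of 1 t] elim \<open>a > 0\<close> by (simp add: field_simps)
      \<comment> \<open>Expanding \<open>(\<bar>f t\<bar> - 1)\<^sup>2 \<ge> 0\<close> turns the
        bound on the square into one on \<open>f\<close> without square roots.\<close>
      moreover have "\<bar>f t\<bar> \<le> 1 + (f t)\<^sup>2"
        using zero_le_power2[of "\<bar>f t\<bar> - 1"] zero_le_power2[of "f t"]
        by (simp add: power2_diff)
      ultimately show ?case by simp
    qed
    show "1 + V 1 / a > 0" using \<open>0 \<le> V 1\<close> \<open>a > 0\<close> by (simp add: add_pos_nonneg)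
  qed
  have O_x: "x \<in> O[at_top](\<lambda>_. 1)" using terms by (intro bounded[of 1]) (auto simp: V_def)
  have O_s: "s \<in> O[at_top](\<lambda>_. 1)" using terms pos by (intro bounded[of c]) (auto simp: V_def)
  have O_y: "y \<in> O[at_top](\<lambda>_. 1)" using terms pos by (intro bounded[of b]) (auto simp: V_def)
  have O_z: "z \<in> O[at_top](\<lambda>_. 1)"
    using terms pos by (intro bounded[of "b * e"]) (auto simp: V_def)
  \<comment> \<open>Zero coefficients must be covered, since \<open>d\<close> may vanish.\<close>
  have O_cmult: "(\<lambda>t. a * f t) \<in> O[at_top](\<lambda>_. 1)" if "f \<in> O[at_top](\<lambda>_. 1)"
    for a :: real and f :: "real \<Rightarrow> real"
    using that by (cases "a = 0") simp_all
  have O_uminus: "(\<lambda>t. - f t) \<in> O[at_top](\<lambda>_. 1)" if "f \<in> O[at_top](\<lambda>_. 1)" for f :: "real \<Rightarrow> real"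
    using that by simp
  have O_x1: "x1 \<in> O[at_top](\<lambda>_. 1)" and O_y1: "y1 \<in> O[at_top](\<lambda>_. 1)"
    unfolding x1_def y1_def
    by (intro sum_in_bigo O_uminus O_cmult O_x O_s O_y O_z)+
  have O_x2: "x2 \<in> O[at_top](\<lambda>_. 1)" and O_y2: "y2 \<in> O[at_top](\<lambda>_. 1)"
    unfolding x2_def y2_def
    by (intro sum_in_bigo O_uminus O_cmult O_x O_x1 O_y O_y1)+
  have O_x3: "x3 \<in> O[at_top](\<lambda>_. 1)" and O_y3: "y3 \<in> O[at_top](\<lambda>_. 1)"
    unfolding x3_def y3_def
    by (intro sum_in_bigo O_uminus O_cmult O_x1 O_x2 O_y1 O_y2)+
  have "(\<lambda>t. x t * x1 t) \<in> O[at_top](\<lambda>_. 1)" "(\<lambda>t. y t * y1 t) \<in> O[at_top](\<lambda>_. 1)"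
    by (intro landau_o.big.mult_in_1 O_x O_x1 O_y O_y1)+
  then have O_V2: "V2 \<in> O[at_top](\<lambda>_. 1)"
    unfolding V2_def by (intro sum_in_bigo O_cmult)

  have V1_lim: "(V1 \<longlongrightarrow> 0) at_top"
    by (rule barbalat[OF ev[OF dV] ev[OF dV1] O_V2 V_lim])
  have "((\<lambda>t. (x t)\<^sup>2) \<longlongrightarrow> 0) at_top"
  proof (rule tendsto_sandwich[where f = "\<lambda>_. 0"])
    show "\<forall>\<^sub>F t in at_top. (x t)\<^sup>2 \<le> - V1 t / (2 * k)"
    proof (rule always_eventually, rule allI)
      fix t
      \<comment> \<open>The \<open>y\<close> part of \<open>- V1 t\<close> is nonnegative and is
        dropped.\<close>
      have "2 * k * (x t)\<^sup>2 \<le> - V1 t"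
        using dissipation[of t] by (simp add: V1_def power2_eq_square)
      then show "(x t)\<^sup>2 \<le> - V1 t / (2 * k)"
        using pos by (simp add: field_simps)
    qed
    show "((\<lambda>t. - V1 t / (2 * k)) \<longlongrightarrow> 0) at_top"
      using tendsto_divide[OF tendsto_minus[OF V1_lim] tendsto_const, of "2 * k"] pos by simp
  qed simp_all
  then show x_lim: "(x \<longlongrightarrow> 0) at_top" by simp
  have x1_lim: "(x1 \<longlongrightarrow> 0) at_top"
    by (rule barbalat[OF ev[OF dx] ev[OF dx1] O_x2 x_lim])
  have x2_lim: "(x2 \<longlongrightarrow> 0) at_top"
    by (rule barbalat[OF ev[OF dx1] ev[OF dx2] O_x3 x1_lim])
  \<comment> \<open>The definition of \<open>x2\<close> solved for \<open>y1\<close>, which is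
    possible because \<open>b\<close> is nonzero.\<close>
  have "((\<lambda>t. (x2 t + k * x1 t + c * x t) / b) \<longlongrightarrow> (0 + k * 0 + c * 0) / b) at_top"
    using pos by (intro tendsto_intros x_lim x1_lim x2_lim) simp
  moreover have "(\<lambda>t. (x2 t + k * x1 t + c * x t) / b) = y1"
    using pos by (simp add: x2_def fun_eq_iff)
  ultimately have y1_lim: "(y1 \<longlongrightarrow> 0) at_top" by simp
  have y2_lim: "(y2 \<longlongrightarrow> 0) at_top"
    by (rule barbalat[OF ev[OF dy1] ev[OF dy2] O_y3 y1_lim])
  \<comment> \<open>Likewise, the definition of \<open>y2\<close> solved for \<open>y\<close>, using
    that \<open>e\<close> is nonzero.\<close>
  have "((\<lambda>t. - (y2 t + x1 t + d * y1 t) / e) \<longlongrightarrow> - (0 + 0 + d * 0) / e) at_top"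
    using pos by (intro tendsto_intros x1_lim y1_lim y2_lim) simp
  moreover have "(\<lambda>t. - (y2 t + x1 t + d * y1 t) / e) = y"
    using pos by (simp add: y2_def fun_eq_iff)
  ultimately show "(y \<longlongrightarrow> 0) at_top" by simp
qed

theorem theorem5:
  fixes C\<^sub>f C\<^sub>r L\<^sub>f L\<^sub>r J v :: real
    and a\<^sub>2\<^sub>1 a\<^sub>2\<^sub>2 b\<^sub>2\<^sub>1 \<delta>\<^sub>r :: real
    and K_p1 K_i1 K_p2 K_i2 :: real
    and \<beta> \<beta>_dot r_kin r_kin_dot r_kin_ddot :: "real \<Rightarrow> real"
    and r_dyn \<phi>_act \<omega> r_e r_e_dot \<sigma>\<^sub>r \<phi>_des \<phi>_e \<sigma>\<^sub>\<phi> :: "real \<Rightarrow> real"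
  assumes "C\<^sub>f > 0" and "C\<^sub>r > 0" and "L\<^sub>f > 0" and "L\<^sub>r > 0" and "J > 0" and "v > 0"
    and "a\<^sub>2\<^sub>1 = - ((C\<^sub>f * L\<^sub>f - C\<^sub>r * L\<^sub>r) / J)"
    and "a\<^sub>2\<^sub>2 = - ((C\<^sub>f * L\<^sub>f\<^sup>2 + C\<^sub>r * L\<^sub>r\<^sup>2) / (J * v))"
    and "b\<^sub>2\<^sub>1 = C\<^sub>f * L\<^sub>f / J"
    \<comment> \<open>\<open>a\<^sub>2\<^sub>2 < 0\<close>, and \<open>K_p2 > a\<^sub>2\<^sub>2\<close> alone admits gains for which the closed loop diverges,
      so the sign condition \<open>0 \<le> K_p2\<close> is required in addition.\<close>
    and "K_p1 > a\<^sub>2\<^sub>2" and "K_i1 > 0" and "K_p2 > a\<^sub>2\<^sub>2" and "K_p2 \<ge> 0" and "K_i2 > 0"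
    and "\<And>t. t \<ge> 0 \<Longrightarrow> (\<beta> has_real_derivative \<beta>_dot t) (at t within {0..})"
    and "\<And>t. t \<ge> 0 \<Longrightarrow> (r_kin has_real_derivative r_kin_dot t) (at t within {0..})"
    and "\<And>t. t \<ge> 0 \<Longrightarrow> (r_kin_dot has_real_derivative r_kin_ddot t) (at t within {0..})"
    and "\<And>t. t \<ge> 0 \<Longrightarrow> (r_dyn has_real_derivative
           (a\<^sub>2\<^sub>1 * \<beta> t + a\<^sub>2\<^sub>2 * r_dyn t + b\<^sub>2\<^sub>1 * \<phi>_act t + \<delta>\<^sub>r)) (at t within {0..})"
    and "\<And>t. t \<ge> 0 \<Longrightarrow> (\<phi>_act has_real_derivative \<omega> t) (at t within {0..})"
    and "\<And>t. t \<ge> 0 \<Longrightarrow> r_e t = r_kin t - r_dyn t"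
    and "\<And>t. t \<ge> 0 \<Longrightarrow> (r_e has_real_derivative r_e_dot t) (at t within {0..})"
    and "\<And>t. t \<ge> 0 \<Longrightarrow> (\<sigma>\<^sub>r has_real_derivative r_e t) (at t within {0..})"
    and "\<And>t. t \<ge> 0 \<Longrightarrow> \<phi>_des t =
           - ((a\<^sub>2\<^sub>1 * \<beta> t - r_kin_dot t + a\<^sub>2\<^sub>2 * r_kin t - K_p1 * r_e t - K_i1 * \<sigma>\<^sub>r t) / b\<^sub>2\<^sub>1)"
    and "\<And>t. t \<ge> 0 \<Longrightarrow> \<phi>_e t = \<phi>_des t - \<phi>_act t"
    and "\<And>t. t \<ge> 0 \<Longrightarrow> (\<sigma>\<^sub>\<phi> has_real_derivative \<phi>_e t) (at t within {0..})"
    and "\<And>t. t \<ge> 0 \<Longrightarrow> \<omega> t =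
           - ((a\<^sub>2\<^sub>1 * \<beta>_dot t + (a\<^sub>2\<^sub>2 * r_kin_dot t - r_kin_ddot t) - K_p1 * r_e_dot t
                - (K_i1 + b\<^sub>2\<^sub>1) * r_e t) / b\<^sub>2\<^sub>1)
           + K_p2 * \<phi>_e t + K_i2 * \<sigma>\<^sub>\<phi> t"
  shows "(r_e \<longlongrightarrow> 0) at_top \<and> (\<phi>_e \<longlongrightarrow> 0) at_top"
proof -
  note pos = assms(1-6) and b21 = assms(9) and gains = assms(10-14)
    and \<beta> = assms(15) and r_kin = assms(16) and r_kin_dot = assms(17) and r_dyn = assms(18)
    and \<phi>_act = assms(19) and r_e_eq = assms(20) and r_e_dot = assms(21) and \<sigma>\<^sub>r = assms(22)
    and \<phi>_des_eq = assms(23) and \<phi>_e_eq = assms(24) and \<sigma>\<^sub>\<phi> = assms(25) and \<omega>_eq = assms(26)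
  have b: "b\<^sub>2\<^sub>1 > 0" using pos b21 by simp
  have at: "at t within {0..} = at t" if "t > 0" for t :: real
    using that by (intro at_within_interior) simp
  \<comment> \<open>Substituting \<open>\<phi>_act = \<phi>_des - \<phi>_e\<close> cancels the
    \<beta> and \<open>r_kin_dot\<close> terms. The constant \<open>\<delta>\<^sub>r\<close> is
    absorbed by shifting the integral state, which leaves the derivative of that state
    unchanged.\<close>
  have d_r_e: "(r_e has_real_derivative
      - (K_p1 - a\<^sub>2\<^sub>2) * r_e t - K_i1 * (\<sigma>\<^sub>r t + \<delta>\<^sub>r / K_i1) + b\<^sub>2\<^sub>1 * \<phi>_e t) (at t)"
    if "t > 0" for t
  proof -
    have "((\<lambda>t. r_kin t - r_dyn t) has_real_derivative
        r_kin_dot t - (a\<^sub>2\<^sub>1 * \<beta> t + a\<^sub>2\<^sub>2 * r_dyn t + b\<^sub>2\<^sub>1 * \<phi>_act t + \<delta>\<^sub>r)) (at t)"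
      using DERIV_diff[OF r_kin r_dyn, of t] that by (simp add: at)
    then have "(r_e has_real_derivative
        r_kin_dot t - (a\<^sub>2\<^sub>1 * \<beta> t + a\<^sub>2\<^sub>2 * r_dyn t + b\<^sub>2\<^sub>1 * \<phi>_act t + \<delta>\<^sub>r)) (at t)"
      by (rule has_field_derivative_transform_within_open[of _ _ _ "{0<..}"])
        (use that r_e_eq in auto)
    moreover have "r_kin_dot t - (a\<^sub>2\<^sub>1 * \<beta> t + a\<^sub>2\<^sub>2 * r_dyn t + b\<^sub>2\<^sub>1 * \<phi>_act t + \<delta>\<^sub>r) =
        - (K_p1 - a\<^sub>2\<^sub>2) * r_e t - K_i1 * (\<sigma>\<^sub>r t + \<delta>\<^sub>r / K_i1) + b\<^sub>2\<^sub>1 * \<phi>_e t"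
    proof -
      have "b\<^sub>2\<^sub>1 * \<phi>_des t =
          - (a\<^sub>2\<^sub>1 * \<beta> t - r_kin_dot t + a\<^sub>2\<^sub>2 * r_kin t - K_p1 * r_e t - K_i1 * \<sigma>\<^sub>r t)"
        using that b \<phi>_des_eq[of t] by simp
      moreover have "K_i1 * (\<sigma>\<^sub>r t + \<delta>\<^sub>r / K_i1) = K_i1 * \<sigma>\<^sub>r t + \<delta>\<^sub>r"
        using gains by (simp add: field_simps)
      moreover have "r_dyn t = r_kin t - r_e t" "\<phi>_act t = \<phi>_des t - \<phi>_e t"
        using that r_e_eq[of t] \<phi>_e_eq[of t] by simp_all
      ultimately show ?thesis by (simp add: ring_distribs)
    qed
    ultimately show ?thesis by simp
  qed
  \<comment> \<open>The feedforward part of \<omega> is the derivative of \<open>\<phi>_des\<close>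
    plus \<open>r_e\<close>. That surplus comes from the extra \<open>b\<^sub>2\<^sub>1\<close>
    beside \<open>K_i1\<close>, and it produces the \<open>- r_e t\<close> that the Lyapunov
    function needs for its cancellation.\<close>
  have d_\<phi>_e: "(\<phi>_e has_real_derivative - r_e t - K_p2 * \<phi>_e t - K_i2 * \<sigma>\<^sub>\<phi> t) (at t)"
    if "t > 0" for t
  proof -
    have "((\<lambda>t. - ((a\<^sub>2\<^sub>1 * \<beta> t - r_kin_dot t + a\<^sub>2\<^sub>2 * r_kin t - K_p1 * r_e t - K_i1 * \<sigma>\<^sub>r t) / b\<^sub>2\<^sub>1)
          - \<phi>_act t) has_real_derivative
        - ((a\<^sub>2\<^sub>1 * \<beta>_dot t - r_kin_ddot t + a\<^sub>2\<^sub>2 * r_kin_dot t - K_p1 * r_e_dot t - K_i1 * r_e t) / b\<^sub>2\<^sub>1)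
          - \<omega> t) (at t within {0..})"
      using that by (intro DERIV_diff DERIV_minus DERIV_cdivide DERIV_add DERIV_cmult
          \<beta> r_kin r_kin_dot r_e_dot \<sigma>\<^sub>r \<phi>_act) auto
    moreover have "- ((a\<^sub>2\<^sub>1 * \<beta>_dot t - r_kin_ddot t + a\<^sub>2\<^sub>2 * r_kin_dot t - K_p1 * r_e_dot t - K_i1 * r_e t)
          / b\<^sub>2\<^sub>1) - \<omega> t = - r_e t - K_p2 * \<phi>_e t - K_i2 * \<sigma>\<^sub>\<phi> t"
      using that b \<omega>_eq[of t] by (simp add: field_simps)
    ultimately have "((\<lambda>t. - ((a\<^sub>2\<^sub>1 * \<beta> t - r_kin_dot t + a\<^sub>2\<^sub>2 * r_kin t - K_p1 * r_e t - K_i1 * \<sigma>\<^sub>r t) / b\<^sub>2\<^sub>1)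
          - \<phi>_act t) has_real_derivative - r_e t - K_p2 * \<phi>_e t - K_i2 * \<sigma>\<^sub>\<phi> t) (at t)"
      using at[OF that] by simp
    then show ?thesis
      by (rule has_field_derivative_transform_within_open[of _ _ _ "{0<..}"])
        (use that \<phi>_e_eq \<phi>_des_eq in auto)
  qed
  have d_\<sigma>: "((\<lambda>t. \<sigma>\<^sub>r t + \<delta>\<^sub>r / K_i1) has_real_derivative r_e t) (at t)"
    "(\<sigma>\<^sub>\<phi> has_real_derivative \<phi>_e t) (at t)" if "t > 0" for t
    using DERIV_add[OF \<sigma>\<^sub>r DERIV_const, of t] \<sigma>\<^sub>\<phi>[of t] that by (simp_all add: at)
  have "K_p1 - a\<^sub>2\<^sub>2 > 0" using gains by simp
  from closed_loop_tendsto_0[OF this \<open>K_i1 > 0\<close> b \<open>K_p2 \<ge> 0\<close> \<open>K_i2 > 0\<close> d_r_e d_\<sigma>(1) d_\<phi>_e d_\<sigma>(2)]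
  show ?thesis by blast
qed

end
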